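(* Let $m,n\ge 1$ be integers and let $c=(a_1,\ldots,a_m;b_1,\ldots,b_{n-1},-)$ be a stable configuration of the Abelian sandpile model on the complete split graph $S_{m,n}$ with sink the independent vertex $w_n$ (here $a_i$ is the number of grains at $v_i$ and $b_j$ the number of grains at $w_j$). Suppose $c$ is weakly decreasing, i.e. $a_1\ge\cdots\ge a_m$ and $b_1\ge\cdots\ge b_{n-1}$. Then $c$ is recurrent if and only if there is a unique $DH$-Motzkin word $\alpha\in\mathsf{Motzkin}_{m,n-1}$ such that $g(\alpha)=c$.
   Context: The complete split graph $S_{m,n}$ has clique vertices $v_1,\ldots,v_m$ and independent vertices $w_1,\ldots,w_n$. Every two distinct clique vertices are joined by one edge, every clique vertex is joined to every independent vertex by one edge, and no two independent vertices are adjacent. Abelian sandpile model on a graph $G$ with sink $s$: a configuration assigns a non-negative integer (number of grains) to each non-sink vertex. A non-sink vertex $v$ is stable if its number of grains is strictly less than $\deg(v)$, and unstable otherwise. A configuration is stable if all non-sink vertices are stable. An unstable vertex may topple, i.e. it loses $\deg(v)$ grains and gives one grain to each neighbour; grains given to the sink disappear. Toppling unstable vertices eventually leads to a unique stable configuration, the stabilisation. A stable configuration $c$ is recurrent if it can be reached, by adding grains and toppling, from every configuration: for every configuration $d$ there is a configuration $e$ such that the stabilisation of $d+e$ is $c$. A Motzkin word is a word in the letters $U,D,H$ such that every prefix contains at least as many $U$'s as $D$'s, and the total numbers of $U$'s and $D$'s are equal. $\mathsf{Motzkin}_{p,q}$ is the set of Motzkin words with exactly $p$ letters $U$ and $q$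 letters $H$. A $DH$-Motzkin word is a Motzkin word in which the first occurrence of $H$ appears after the first occurrence of $D$ (a vacuous condition if there is no $H$). For a $DH$-Motzkin word $\alpha\in\mathsf{Motzkin}_{m,n-1}$, the configuration $g(\alpha)=(a_1,\ldots,a_m;b_1,\ldots,b_{n-1},-)$ is defined by: $a_i+1$ is the number of letters of $\alpha$ equal to $D$ or $H$ appearing after the $i$-th occurrence of $U$; $b_i$ is the number of letters $D$ appearing after the $i$-th occurrence of $H$ in $\alpha$. The dash marks the sink and the semicolon separates clique from independent vertices. *)

theory Defs
  imports Main
begin

text \<open>A finite simple graph is a vertex set together with a set of two-element subsets of it.\<close>

type_synonym 'v graph = "'v set \<times> 'v set set"

definition neighbours :: "'v graph \<Rightarrow> 'v \<Rightarrow> 'v set" where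
  "neighbours G v = {u \<in> fst G. {v, u} \<in> snd G}"

definition degree :: "'v graph \<Rightarrow> 'v \<Rightarrow> nat" where
  "degree G v = card (neighbours G v)"

text \<open>Configurations assign grains to the non-sink vertices only. They are encoded as total
  functions that vanish elsewhere, so that equality of functions is equality of configurations.\<close>

definition configurations :: "'v graph \<Rightarrow> 'v \<Rightarrow> ('v \<Rightarrow> nat) set" where
  "configurations G s = {c. \<forall>v. v \<notin> fst G - {s} \<longrightarrow> c v = 0}"

definition stable :: "'v graph \<Rightarrow> 'v \<Rightarrow> ('v \<Rightarrow> nat) \<Rightarrow> bool" where
  "stable G s c \<longleftrightarrow> (\<forall>v \<in> fst G - {s}. c v < degree G v)"

text \<open>The value at the sink is left untouched: grains sent there disappear.\<close>

definition topple :: "'v graph \<Rightarrow> 'v \<Rightarrow> 'v \<Rightarrow> ('v \<Rightarrow> nat) \<Rightarrow> ('v \<Rightarrow> nat)" where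
  "topple G s v c = (\<lambda>u. if u = s then c u
                         else if u = v then c u - degree G v
                         else if u \<in> neighbours G v then c u + 1
                         else c u)"

definition topples_to :: "'v graph \<Rightarrow> 'v \<Rightarrow> ('v \<Rightarrow> nat) \<Rightarrow> ('v \<Rightarrow> nat) \<Rightarrow> bool" where
  "topples_to G s c c' \<longleftrightarrow> (\<exists>v \<in> fst G - {s}. degree G v \<le> c v \<and> c' = topple G s v c)"

text \<open>``The stabilisation of \<open>c\<close> is \<open>c'\<close>'', as a relation; it is single-valued by
  \<open>stabilisation_unique\<close> below.\<close>

definition stabilises_to :: "'v graph \<Rightarrow> 'v \<Rightarrow> ('v \<Rightarrow> nat) \<Rightarrow> ('v \<Rightarrow> nat) \<Rightarrow> bool" where
  "stabilises_to G s c c' \<longleftrightarrow> (topples_to G s)\<^sup>*\<^sup>* c c' \<and> stable G s c'"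

definition recurrent :: "'v graph \<Rightarrow> 'v \<Rightarrow> ('v \<Rightarrow> nat) \<Rightarrow> bool" where
  "recurrent G s c \<longleftrightarrow> c \<in> configurations G s \<and> stable G s c \<and>
     (\<forall>d \<in> configurations G s. \<exists>e \<in> configurations G s. stabilises_to G s (\<lambda>v. d v + e v) c)"

lemma topple_commute:
  assumes "u \<noteq> v" "degree G u \<le> c u" "degree G v \<le> c v"
  shows "topple G s u (topple G s v c) = topple G s v (topple G s u c)"
  using assms by (auto simp: topple_def fun_eq_iff)

lemma topple_other_ge: "u \<noteq> v \<Longrightarrow> c u \<le> topple G s v c u"
  by (simp add: topple_def)

lemma topples_to_diamond:
  assumes "topples_to G s c d" "topples_to G s c e" "d \<noteq> e"
  shows "\<exists>f. topples_to G s d f \<and> topples_to G s e f"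
proof -
  obtain v where v: "v \<in> fst G - {s}" "degree G v \<le> c v" "d = topple G s v c"
    using assms(1) by (auto simp: topples_to_def)
  obtain u where u: "u \<in> fst G - {s}" "degree G u \<le> c u" "e = topple G s u c"
    using assms(2) by (auto simp: topples_to_def)
  have "u \<noteq> v" using assms(3) u v by auto
  then have "degree G u \<le> d u" "degree G v \<le> e v"
    using u v topple_other_ge[of u v c G s] topple_other_ge[of v u c G s] by auto
  moreover have "topple G s u d = topple G s v e"
    using topple_commute[OF \<open>u \<noteq> v\<close>] u v by simp
  ultimately have "topples_to G s d (topple G s u d)" "topples_to G s e (topple G s u d)"
    using u(1) v(1) by (auto simp: topples_to_def)
  then show ?thesis by blast
qed

lemma topples_to_strip:
  assumes "(topples_to G s)\<^sup>*\<^sup>* c d" "topples_to G s c e"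
  shows "\<exists>f. (topples_to G s)\<^sup>*\<^sup>* e f \<and> (d = f \<or> topples_to G s d f)"
  using assms
proof (induction rule: rtranclp_induct)
  case base
  then show ?case by blast
next
  case (step d d')
  then obtain f where f: "(topples_to G s)\<^sup>*\<^sup>* e f" "d = f \<or> topples_to G s d f" by blast
  consider "d = f" | "d' = f" | "topples_to G s d f" "d' \<noteq> f" using f(2) by blast
  then show ?case
  proof cases
    case 1
    then have "(topples_to G s)\<^sup>*\<^sup>* e d'"
      using f(1) step.hyps(2) rtranclp.rtrancl_into_rtrancl[of "topples_to G s" e d d'] by simp
    then show ?thesis by blast
  next
    case 2
    then show ?thesis using f(1) by blast
  next
    case 3
    then obtain h where h: "topples_to G s d' h" "topples_to G s f h"
      using topples_to_diamond[OF step.hyps(2)] by blast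
    then have "(topples_to G s)\<^sup>*\<^sup>* e h"
      using f(1) rtranclp.rtrancl_into_rtrancl[of "topples_to G s" e f h] by simp
    then show ?thesis using h(1) by blast
  qed
qed

lemma stable_no_topple: "stable G s c \<Longrightarrow> \<not> topples_to G s c d"
  unfolding stable_def topples_to_def by (meson not_le)

theorem stabilisation_unique:
  assumes "stabilises_to G s c d" "stabilises_to G s c e"
  shows "d = e"
proof -
  have "(topples_to G s)\<^sup>*\<^sup>* c e \<Longrightarrow> (topples_to G s)\<^sup>*\<^sup>* c d \<Longrightarrow> d = e"
    if d: "stable G s d" and e: "stable G s e"
  proof (induction rule: converse_rtranclp_induct)
    case base
    then show ?case
      by (cases rule: converse_rtranclpE) (simp_all add: stable_no_topple[OF e])
  next
    case (step c c')
    obtain f where "(topples_to G s)\<^sup>*\<^sup>* c' f" "d = f \<or> topples_to G s d f"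
      using topples_to_strip[OF step.prems step.hyps(1)] by blast
    then show ?case using step.IH stable_no_topple[OF d] by blast
  qed
  then show ?thesis using assms by (simp add: stabilises_to_def)
qed

text \<open>\<open>Clique i\<close> is $v_i$ and \<open>Indep j\<close> is $w_j$; indices start at 1.\<close>

datatype vertex = Clique nat | Indep nat

definition complete_split_graph :: "nat \<Rightarrow> nat \<Rightarrow> vertex graph" where
  "complete_split_graph m n =
     (Clique ` {1..m} \<union> Indep ` {1..n},
      {{Clique i, Clique j} | i j. i \<in> {1..m} \<and> j \<in> {1..m} \<and> i \<noteq> j} \<union>
      {{Clique i, Indep j} | i j. i \<in> {1..m} \<and> j \<in> {1..n}})"

definition weakly_decreasing :: "nat \<Rightarrow> nat \<Rightarrow> (vertex \<Rightarrow> nat) \<Rightarrow> bool" where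
  "weakly_decreasing m n c \<longleftrightarrow>
     (\<forall>i j. 1 \<le> i \<and> i \<le> j \<and> j \<le> m \<longrightarrow> c (Clique i) \<ge> c (Clique j)) \<and>
     (\<forall>i j. 1 \<le> i \<and> i \<le> j \<and> j \<le> n - 1 \<longrightarrow> c (Indep i) \<ge> c (Indep j))"

datatype letter = U | D | H

definition motzkin_word :: "letter list \<Rightarrow> bool" where
  "motzkin_word w \<longleftrightarrow>
     (\<forall>k \<le> length w. count_list (take k w) D \<le> count_list (take k w) U) \<and>
     count_list w U = count_list w D"

definition Motzkin :: "nat \<Rightarrow> nat \<Rightarrow> letter list set" where
  "Motzkin p q = {w. motzkin_word w \<and> count_list w U = p \<and> count_list w H = q}"

definition DH_Motzkin_word :: "letter list \<Rightarrow> bool" where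
  "DH_Motzkin_word w \<longleftrightarrow> motzkin_word w \<and>
     (\<forall>xs ys. w = xs @ H # ys \<and> H \<notin> set xs \<longrightarrow> D \<in> set xs)"

text \<open>The part of \<open>w\<close> after the \<open>i\<close>-th occurrence of \<open>x\<close>, for \<open>1 \<le> i \<le> count_list w x\<close>.\<close>

definition after_occurrence :: "'a \<Rightarrow> nat \<Rightarrow> 'a list \<Rightarrow> 'a list" where
  "after_occurrence x i w = drop (Suc (filter (\<lambda>p. w ! p = x) [0..<length w] ! (i - 1))) w"

text \<open>The subtraction for \<open>Clique i\<close> does not truncate: in a Motzkin word every \<open>U\<close> is followed
  by some \<open>D\<close>.\<close>

definition g :: "nat \<Rightarrow> nat \<Rightarrow> letter list \<Rightarrow> vertex \<Rightarrow> nat" where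
  "g m n w v = (case v of
      Clique i \<Rightarrow> if 1 \<le> i \<and> i \<le> m
        then count_list (after_occurrence U i w) D + count_list (after_occurrence U i w) H - 1
        else 0
    | Indep j \<Rightarrow> if 1 \<le> j \<and> j \<le> n - 1 then count_list (after_occurrence H j w) D else 0)"

end

theory Submission
  imports Defs
begin

text \<open>Recurrence is first turned into a static condition. Call \<open>c\<close> allowed if every nonempty set
  \<open>F\<close> of non-sink vertices has a vertex \<open>v\<close> holding at least as many grains as it has neighbours in
  \<open>F\<close>. For stable configurations on any finite simple graph, recurrent means allowed
  (\<open>burning_criterion\<close>). Necessity: reach \<open>c\<close> from a configuration in which every vertex is
  unstable; the vertex of \<open>F\<close> whose last toppling comes first has since received a grain from each
  of its neighbours in \<open>F\<close>. Sufficiency: if \<open>c\<close> is allowed and the sink gives a grain to each of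
  its neighbours, then every other vertex topples exactly once and \<open>c\<close> returns, so \<open>c\<close> absorbs any
  number of such gifts; and with enough of them the grains can be spread so as to exceed any
  prescribed configuration \<open>d\<close>.

  Next, for a Motzkin word \<open>w\<close> the equation \<open>g m n w = c\<close> says how many letters
  other than \<open>U\<close> follow each \<open>U\<close> of \<open>w\<close>, and how many letters \<open>D\<close> follow each \<open>H\<close>. The second piece of information rebuilds the word
  in \<open>D\<close> and \<open>H\<close> that is left when the \<open>U\<close>'s are deleted, and the first tells where to insert the
  \<open>U\<close>'s. Hence for a weakly decreasing stable \<open>c\<close> there is exactly one word \<open>w\<close> with the right
  numbers of letters that encodes \<open>c\<close> in this way (\<open>encodes_exists\<close>, \<open>encodes_unique\<close>), whether or
  not \<open>c\<close> is recurrent. Uniqueness in the theorem is therefore automatic, and the condition on the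
  first \<open>D\<close> and the first \<open>H\<close> is the stability of the vertex \<open>Indep 1\<close>. What remains is that \<open>w\<close> is a
  Motzkin word if and only if \<open>c\<close> is allowed.

  Since \<open>c\<close> is weakly decreasing, the sets \<open>F\<close> that matter consist of the last \<open>p\<close> clique
  vertices and the last \<open>q\<close> independent ones. Such an \<open>F\<close> witnesses that \<open>c\<close> is not allowed if
  fewer than \<open>p + q\<close> letters other than \<open>U\<close> follow the \<open>p\<close>-th last \<open>U\<close>, and fewer than \<open>p\<close> letters
  \<open>D\<close> follow the \<open>q\<close>-th last \<open>H\<close>. The word fails to be Motzkin if some suffix starting with a \<open>U\<close>
  has more \<open>U\<close>'s than \<open>D\<close>'s, and then the numbers of \<open>U\<close>'s and \<open>H\<close>'s in that suffix are such \<open>p\<close>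
  and \<open>q\<close>. Conversely, such \<open>p\<close> and \<open>q\<close> make the suffix that starts at the \<open>p\<close>-th last \<open>U\<close> a bad one:
  if it had at least \<open>p\<close> letters \<open>D\<close>, it would have fewer than \<open>q\<close> letters \<open>H\<close>, so all of it would follow the
  \<open>q\<close>-th last \<open>H\<close>, which is followed by fewer than \<open>p\<close> letters \<open>D\<close>.\<close>

section \<open>The burning criterion\<close>

lemma topples_to_add:
  assumes "(topples_to G s)\<^sup>*\<^sup>* c d"
  shows "(topples_to G s)\<^sup>*\<^sup>* (\<lambda>v. c v + x v) (\<lambda>v. d v + x v)"
  using assms
proof (induction rule: rtranclp_induct)
  case (step d e)
  then obtain v where v: "v \<in> fst G - {s}" "degree G v \<le> d v" "e = topple G s v d"
    by (auto simp: topples_to_def)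
  then have "(\<lambda>u. e u + x u) = topple G s v (\<lambda>u. d u + x u)"
    by (auto simp: topple_def fun_eq_iff)
  with v have "topples_to G s (\<lambda>u. d u + x u) (\<lambda>u. e u + x u)"
    by (auto simp: topples_to_def intro!: bexI[of _ v])
  with step.IH show ?case by simp
qed simp

text \<open>Confluence: a stable configuration that can be reached from \<open>c\<close> can still be reached after any
  toppling has been done. This lets grains be spread before the configuration is stabilised.\<close>

lemma topples_to_stable:
  assumes "(topples_to G s)\<^sup>*\<^sup>* c e" and "(topples_to G s)\<^sup>*\<^sup>* c d" and "stable G s d"
  shows "(topples_to G s)\<^sup>*\<^sup>* e d"
  using assms(1)
proof (induction rule: rtranclp_induct)
  case base
  show ?case by (rule assms(2))
next
  case (step e e')
  then show ?case
    using topples_to_strip[OF step.IH step.hyps(2)] stable_no_topple[OF assms(3)] by blast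
qed

lemma configurations_topples:
  assumes "(topples_to G s)\<^sup>*\<^sup>* c d" and "c \<in> configurations G s"
  shows "d \<in> configurations G s"
  using assms
proof (induction rule: rtranclp_induct)
  case (step d e)
  obtain v where v: "v \<in> fst G - {s}" "e = topple G s v d"
    using step.hyps(2) by (auto simp: topples_to_def)
  have "d \<in> configurations G s" by (rule step.IH[OF step.prems])
  then have zero: "d u = 0" if "u \<notin> fst G - {s}" for u
    using that by (simp add: configurations_def)
  have "e u = 0" if "u \<notin> fst G - {s}" for u
  proof -
    have "u = s \<or> u \<noteq> v \<and> u \<notin> neighbours G v"
      using that v(1) by (auto simp: neighbours_def)
    then show ?thesis using zero[OF that] unfolding v(2) topple_def by auto
  qed
  then show ?case by (auto simp: configurations_def)
qed

text \<open>A set \<open>F\<close> violating this condition is known as a forbidden subconfiguration.\<close>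

definition allowed :: "'v graph \<Rightarrow> 'v \<Rightarrow> ('v \<Rightarrow> nat) \<Rightarrow> bool" where
  "allowed G s c \<longleftrightarrow>
     (\<forall>F. F \<noteq> {} \<and> F \<subseteq> fst G - {s} \<longrightarrow> (\<exists>v\<in>F. card (neighbours G v \<inter> F) \<le> c v))"

locale loopless_graph_with_sink =
  fixes G :: "'v graph" and s :: 'v
  assumes finite_vertices: "finite (fst G)"
    and sink: "s \<in> fst G"
    and loopless: "v \<notin> neighbours G v"
begin

abbreviation reaches :: "('v \<Rightarrow> nat) \<Rightarrow> ('v \<Rightarrow> nat) \<Rightarrow> bool" (infix \<open>\<leadsto>\<close> 50) where
  "c \<leadsto> d \<equiv> (topples_to G s)\<^sup>*\<^sup>* c d"

lemma finite_neighbours [simp]: "finite (neighbours G v)"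
  using finite_vertices by (simp add: neighbours_def)

lemma neighbours_sym: "u \<in> fst G \<Longrightarrow> v \<in> fst G \<Longrightarrow> u \<in> neighbours G v \<longleftrightarrow> v \<in> neighbours G u"
  by (simp add: neighbours_def insert_commute)

lemma neighbours_subset: "neighbours G v \<subseteq> fst G"
  by (auto simp: neighbours_def)

text \<open>The condition defining \<open>allowed\<close> is preserved along a toppling sequence for all \<open>F\<close> inside the set
  of vertices that have toppled: when \<open>u \<in> F\<close> topples, use the vertex found for \<open>F - {u}\<close>; the grain
  received from \<open>u\<close> pays for \<open>u\<close> as a further neighbour. Starting from a configuration without
  stable non-sink vertices, every vertex must have toppled by the time that \<open>c\<close> is reached.\<close>

lemma recurrent_imp_allowed:
  assumes "recurrent G s c"
  shows "allowed G s c"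
proof -
  \<comment> \<open>Every non-sink vertex of \<open>d\<close> is unstable.\<close>
  define d where "d v = (if v \<in> fst G - {s} then degree G v else 0)" for v
  have "d \<in> configurations G s" by (auto simp: d_def configurations_def)
  then obtain e where e: "stabilises_to G s (\<lambda>v. d v + e v) c"
    using assms by (auto simp: recurrent_def)
  \<comment> \<open>\<open>T\<close> is the set of vertices toppled so far.\<close>
  have "\<exists>T. T \<subseteq> fst G - {s} \<and> (\<forall>v\<in>fst G - {s} - T. degree G v \<le> x v) \<and>
            (\<forall>F. F \<noteq> {} \<and> F \<subseteq> T \<longrightarrow> (\<exists>v\<in>F. card (neighbours G v \<inter> F) \<le> x v))"
    if "(\<lambda>v. d v + e v) \<leadsto> x" for x
    using that
  proof (induction rule: rtranclp_induct)
    case base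
    show ?case by (rule exI[of _ "{}"]) (simp add: d_def)
  next
    case (step x y)
    from step.IH obtain T where T: "T \<subseteq> fst G - {s}"
      "\<forall>v\<in>fst G - {s} - T. degree G v \<le> x v"
      "\<forall>F. F \<noteq> {} \<and> F \<subseteq> T \<longrightarrow> (\<exists>v\<in>F. card (neighbours G v \<inter> F) \<le> x v)"
      by (elim exE conjE) (rule that)
    obtain u where u: "u \<in> fst G - {s}" "degree G u \<le> x u" and y: "y = topple G s u x"
      using step.hyps(2) by (auto simp: topples_to_def)
    have ge: "x v \<le> y v" if "v \<noteq> u" for v
      using topple_other_ge[OF that] y by simp
    have "\<exists>v\<in>F. card (neighbours G v \<inter> F) \<le> y v" if F: "F \<noteq> {}" "F \<subseteq> insert u T" for F
    proof (cases "u \<in> F")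
      case False
      then obtain v where "v \<in> F" "card (neighbours G v \<inter> F) \<le> x v"
        using T(3)[rule_format, of F] F by blast
      moreover have "v \<noteq> u" using False \<open>v \<in> F\<close> by blast
      ultimately show ?thesis using ge by (meson order_trans)
    next
      case True
      show ?thesis
      proof (cases "F = {u}")
        case True
        then show ?thesis using loopless by simp
      next
        case False
        then have "F - {u} \<noteq> {}" "F - {u} \<subseteq> T" using F \<open>u \<in> F\<close> by auto
        then obtain v where v: "v \<in> F" "v \<noteq> u" "card (neighbours G v \<inter> (F - {u})) \<le> x v"
          using T(3)[rule_format, of "F - {u}"] by blast
        have vV: "v \<in> fst G - {s}" using v F T u by blast
        have "card (neighbours G v \<inter> F) \<le> y v"
        proof (cases "u \<in> neighbours G v")
          case True
          then have "neighbours G v \<inter> F = insert u (neighbours G v \<inter> (F - {u}))"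
            using \<open>u \<in> F\<close> by blast
          then have "card (neighbours G v \<inter> F) = Suc (card (neighbours G v \<inter> (F - {u})))"
            by simp
          moreover have "y v = x v + 1"
            using True vV u v(2) neighbours_sym[of u v] by (auto simp: y topple_def)
          ultimately show ?thesis using v(3) by simp
        next
          case False
          then have "neighbours G v \<inter> F = neighbours G v \<inter> (F - {u})" by blast
          then show ?thesis using v(3) ge[OF v(2)] by simp
        qed
        then show ?thesis using v(1) by blast
      qed
    qed
    moreover have "\<forall>v\<in>fst G - {s} - insert u T. degree G v \<le> y v"
    proof
      fix v assume "v \<in> fst G - {s} - insert u T"
      then have "degree G v \<le> x v" "v \<noteq> u" using T(2) by auto
      then show "degree G v \<le> y v" using ge by (meson order_trans)
    qed
    moreover have "insert u T \<subseteq> fst G - {s}" using T(1) u(1) by blast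
    ultimately show ?case by (intro exI[of _ "insert u T"] conjI allI impI) auto
  qed
  moreover have "(\<lambda>v. d v + e v) \<leadsto> c" and "stable G s c"
    using e by (auto simp: stabilises_to_def)
  ultimately obtain T where T: "T \<subseteq> fst G - {s}" "\<forall>v\<in>fst G - {s} - T. degree G v \<le> c v"
    "\<forall>F. F \<noteq> {} \<and> F \<subseteq> T \<longrightarrow> (\<exists>v\<in>F. card (neighbours G v \<inter> F) \<le> c v)" by meson
  have "T = fst G - {s}"
  proof
    show "fst G - {s} \<subseteq> T"
    proof
      fix v assume v: "v \<in> fst G - {s}"
      with \<open>stable G s c\<close> have "\<not> degree G v \<le> c v"
        by (simp add: stable_def not_le)
      with T(2) v show "v \<in> T" by blast
    qed
  qed (rule T(1))
  then show ?thesis using T(3) by (simp add: allowed_def)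
qed

text \<open>The burning process. The displayed configuration is what \<open>c\<close> has become once the sink and every
  vertex outside \<open>F\<close> have toppled once. The vertex that \<open>allowed\<close> provides for \<open>F\<close> is
  unstable in it, and toppling this vertex shrinks \<open>F\<close>; at \<open>F = {}\<close> every vertex has lost and
  regained its degree. The last premise keeps the subtraction of the degree from being truncated.\<close>

lemma topple_each_once:
  assumes "allowed G s c" and "F \<subseteq> fst G - {s}"
    and "\<forall>v\<in>fst G - {s} - F. degree G v \<le> c v + card (neighbours G v - F)"
  shows "(\<lambda>v. if v \<in> F then c v + card (neighbours G v - F)
              else if v \<in> fst G - {s} then c v + card (neighbours G v - F) - degree G v
              else c v) \<leadsto> c"
proof -
  have "finite F" using assms(2) finite_vertices by (meson finite_Diff finite_subset)
  then show ?thesis using assms(2,3)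
  proof (induction "card F" arbitrary: F)
    case 0
    then have "F = {}" by simp
    then show ?case by (simp add: degree_def if_distrib cong: if_cong)
  next
    case (Suc r)
    let ?x = "\<lambda>F v. if v \<in> F then c v + card (neighbours G v - F)
              else if v \<in> fst G - {s} then c v + card (neighbours G v - F) - degree G v
              else c v"
    have "F \<noteq> {}" using Suc.hyps(2) by auto
    then obtain u where u: "u \<in> F" "card (neighbours G u \<inter> F) \<le> c u"
      using assms(1) Suc.prems(2) by (auto simp: allowed_def)
    have split: "card (neighbours G u \<inter> F) + card (neighbours G u - F) = degree G u"
      unfolding degree_def
      using card_Int_Diff[of "neighbours G u" F] by simp
    have uV: "u \<in> fst G - {s}" using u Suc.prems by blast
    have diff: "card (neighbours G v - (F - {u}))
        = card (neighbours G v - F) + (if u \<in> neighbours G v then 1 else 0)" for v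
    proof (cases "u \<in> neighbours G v")
      case True
      then have "neighbours G v - (F - {u}) = insert u (neighbours G v - F)" by blast
      then show ?thesis using True u(1) by simp
    next
      case False
      then have "neighbours G v - (F - {u}) = neighbours G v - F" by blast
      then show ?thesis using False by simp
    qed
    have ready: "degree G v \<le> c v + card (neighbours G v - (F - {u}))"
      if "v \<in> fst G - {s} - (F - {u})" for v
    proof (cases "v = u")
      case True
      then show ?thesis using u(2) split diff[of v] by simp
    next
      case False
      then have "degree G v \<le> c v + card (neighbours G v - F)"
        using that Suc.prems(3) by blast
      then show ?thesis using diff[of v] by simp
    qed
    have "?x (F - {u}) v = topple G s u (?x F) v" for v
    proof -
      consider "v = s" | "v = u" | "v \<notin> fst G" | "v \<in> fst G - {s}" "v \<noteq> u" by blast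
      then show ?thesis
      proof cases
        case 1
        then show ?thesis using Suc.prems(2) by (auto simp: topple_def)
      next
        case 2
        then show ?thesis using uV u(1) diff[of u] loopless[of u] by (simp add: topple_def)
      next
        case 3
        then show ?thesis using Suc.prems(2) uV neighbours_subset[of u] by (auto simp: topple_def)
      next
        case 4
        then have "v \<notin> F \<Longrightarrow> degree G v \<le> c v + card (neighbours G v - F)"
          using Suc.prems(3) by blast
        then show ?thesis
          using 4 diff[of v] uV neighbours_sym[of u v] by (auto simp: topple_def)
      qed
    qed
    then have "topples_to G s (?x F) (?x (F - {u}))"
      using uV u split unfolding topples_to_def by (intro bexI[of _ u]) auto
    moreover have "?x (F - {u}) \<leadsto> c"
    proof (rule Suc.hyps(1))
      show "r = card (F - {u})" using Suc.hyps(2) u(1) Suc.prems(1) by simp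
      show "finite (F - {u})" using Suc.prems by simp
      show "F - {u} \<subseteq> fst G - {s}" using Suc.prems by blast
      show "\<forall>v\<in>fst G - {s} - (F - {u}). degree G v \<le> c v + card (neighbours G v - (F - {u}))"
        using ready by blast
    qed
    ultimately show ?case by (rule converse_rtranclp_into_rtranclp)
  qed
qed

text \<open>At \<open>F = fst G - {s}\<close> only the sink has toppled, so one grain has gone to each of its neighbours.\<close>

lemma allowed_absorbs_sink:
  assumes "allowed G s c" and "c \<in> configurations G s"
  shows "(\<lambda>v. c v + k * of_bool (v \<in> neighbours G s)) \<leadsto> c"
proof -
  let ?V = "fst G - {s}"
  have "card (neighbours G v - ?V) = of_bool (v \<in> neighbours G s)" if "v \<in> ?V" for v
  proof -
    have "neighbours G v - ?V = (if v \<in> neighbours G s then {s} else {})"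
      using neighbours_subset[of v] neighbours_sym[of v s] that sink by auto
    then show ?thesis by simp
  qed
  moreover have "v \<notin> neighbours G s" if "v \<notin> ?V" for v
    using that loopless[of s] neighbours_subset[of s] by blast
  ultimately have start: "(\<lambda>v. if v \<in> ?V then c v + card (neighbours G v - ?V)
      else if v \<in> ?V then c v + card (neighbours G v - ?V) - degree G v else c v)
      = (\<lambda>v. c v + of_bool (v \<in> neighbours G s))"
    by (auto simp: fun_eq_iff)
  have once: "(\<lambda>v. c v + of_bool (v \<in> neighbours G s)) \<leadsto> c"
    using topple_each_once[OF assms(1), of ?V] unfolding start by simp
  show ?thesis
  proof (induction k)
    case (Suc k)
    have "(\<lambda>v. c v + Suc k * of_bool (v \<in> neighbours G s))
        = (\<lambda>v. (c v + of_bool (v \<in> neighbours G s)) + k * of_bool (v \<in> neighbours G s))"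
      by (simp add: fun_eq_iff)
    then have "(\<lambda>v. c v + Suc k * of_bool (v \<in> neighbours G s))
        \<leadsto> (\<lambda>v. c v + k * of_bool (v \<in> neighbours G s))"
      using topples_to_add[OF once] by simp
    then show ?case using Suc by (rule rtranclp_trans)
  qed simp
qed

lemma topple_repeatedly:
  assumes "v \<in> fst G - {s}" and "r * degree G v \<le> d v"
  shows "\<exists>d'. d \<leadsto> d' \<and> d' v = d v - r * degree G v \<and> (\<forall>u. u \<noteq> v \<longrightarrow> d u \<le> d' u) \<and>
              (\<forall>u\<in>neighbours G v - {s}. d' u = d u + r)"
  using assms(2)
proof (induction r)
  case (Suc r)
  then obtain x where x: "d \<leadsto> x" "x v = d v - r * degree G v"
    "\<forall>u. u \<noteq> v \<longrightarrow> d u \<le> x u" "\<forall>u\<in>neighbours G v - {s}. x u = d u + r" by auto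
  have "degree G v \<le> x v" using x(2) Suc.prems by simp
  then have "topples_to G s x (topple G s v x)" using assms(1) by (auto simp: topples_to_def)
  with x(1) have "d \<leadsto> topple G s v x" by simp
  moreover have "topple G s v x v = d v - Suc r * degree G v"
    using x(2) assms(1) by (simp add: topple_def)
  moreover have "\<forall>u. u \<noteq> v \<longrightarrow> d u \<le> topple G s v x u"
    using x(3) topple_other_ge by (metis order_trans)
  moreover have "\<forall>u\<in>neighbours G v - {s}. topple G s v x u = d u + Suc r"
    using x(4) loopless[of v] by (auto simp: topple_def)
  ultimately show ?case by blast
qed auto

text \<open>Let \<open>S\<close> be a set of vertices that can simultaneously be made arbitrarily large. A neighbour of
  the sink can join \<open>S\<close> by raising \<open>k\<close>, a neighbour of \<open>v \<in> S\<close> by toppling \<open>v\<close> repeatedly. A maximal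
  \<open>S\<close> is everything: otherwise \<open>allowed\<close>, applied to the vertices outside \<open>S\<close>, yields one with at
  most \<open>c u\<close> neighbours there, hence by stability with a neighbour in \<open>S\<close> or the sink itself.
  Connectedness of the graph is thus a consequence of the two assumptions.\<close>

lemma sink_grains_flood:
  assumes "allowed G s c" and "stable G s c"
  shows "\<exists>k d. (\<lambda>v. c v + k * of_bool (v \<in> neighbours G s)) \<leadsto> d \<and> (\<forall>v\<in>fst G - {s}. M \<le> d v)"
proof -
  let ?P = "\<lambda>S. \<forall>M. \<exists>k d. (\<lambda>v. c v + k * of_bool (v \<in> neighbours G s)) \<leadsto> d \<and> (\<forall>v\<in>S. M \<le> d v)"
  have step: "?P (insert u S)"
    if S: "?P S" "S \<subseteq> fst G - {s}" and u: "u \<in> fst G - {s}" "u \<notin> S" "v \<in> insert s S" "u \<in> neighbours G v"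
    for S u v
  proof
    fix M
    show "\<exists>k d. (\<lambda>v. c v + k * of_bool (v \<in> neighbours G s)) \<leadsto> d \<and> (\<forall>v\<in>insert u S. M \<le> d v)"
    proof (cases "v = s")
      case True
      obtain k d where d: "(\<lambda>v. c v + k * of_bool (v \<in> neighbours G s)) \<leadsto> d" "\<forall>v\<in>S. M \<le> d v"
        using S(1) by blast
      have "(\<lambda>v. c v + (k + M) * of_bool (v \<in> neighbours G s))
          \<leadsto> (\<lambda>v. d v + M * of_bool (v \<in> neighbours G s))"
        using topples_to_add[OF d(1), of "\<lambda>v. M * of_bool (v \<in> neighbours G s)"]
        by (simp add: algebra_simps)
      moreover have "\<forall>v\<in>insert u S. M \<le> d v + M * of_bool (v \<in> neighbours G s)"
        using d(2) True u(4) by (auto intro: trans_le_add1)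
      ultimately show ?thesis by blast
    next
      case False
      then have v: "v \<in> S" "v \<in> fst G - {s}" using u S by auto
      \<comment> \<open>Toppling \<open>v\<close> \<open>M\<close> times costs it \<open>M * degree G v\<close> grains, which are stocked up first.\<close>
      obtain k d where d: "(\<lambda>v. c v + k * of_bool (v \<in> neighbours G s)) \<leadsto> d"
        "\<forall>v'\<in>S. M + M * degree G v \<le> d v'"
        using S(1) by blast
      have "M * degree G v \<le> d v" using d(2) v by (meson le_add2 order_trans)
      then obtain x where x: "d \<leadsto> x" "x v = d v - M * degree G v"
        "\<forall>u. u \<noteq> v \<longrightarrow> d u \<le> x u" "\<forall>u\<in>neighbours G v - {s}. x u = d u + M"
        using topple_repeatedly[OF v(2), of M d] by blast
      have "M \<le> x w" if "w \<in> insert u S" for w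
      proof (cases "w = v")
        case True
        then show ?thesis using x(2) d(2) v(1) by fastforce
      next
        case False
        show ?thesis
        proof (cases "w = u")
          case True
          then show ?thesis using x(4) u by simp
        next
          case False
          then have "M + M * degree G v \<le> d w" "d w \<le> x w"
            using that d(2) x(3) \<open>w \<noteq> v\<close> by auto
          then show ?thesis by linarith
        qed
      qed
      then show ?thesis using rtranclp_trans[OF d(1) x(1)] by blast
    qed
  qed
  let ?A = "{S. S \<subseteq> fst G - {s} \<and> ?P S}"
  have "finite ?A"
    by (rule finite_subset[of _ "Pow (fst G - {s})"]) (use finite_vertices in auto)
  moreover have "{} \<in> ?A" by blast
  ultimately obtain S where S: "S \<in> ?A" "\<forall>S'\<in>?A. S \<subseteq> S' \<longrightarrow> S = S'"
    using finite_has_maximal[of ?A] by (metis (no_types, lifting) empty_iff)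
  have "S = fst G - {s}"
  proof (rule ccontr)
    assume "S \<noteq> fst G - {s}"
    then have "fst G - {s} - S \<noteq> {}" using S by blast
    then obtain u where u: "u \<in> fst G - {s} - S" "card (neighbours G u \<inter> (fst G - {s} - S)) \<le> c u"
      using assms(1) unfolding allowed_def by (metis (no_types, lifting) Diff_subset)
    have "\<not> neighbours G u \<subseteq> fst G - {s} - S"
    proof
      assume "neighbours G u \<subseteq> fst G - {s} - S"
      then have "neighbours G u \<inter> (fst G - {s} - S) = neighbours G u" by blast
      then have "degree G u \<le> c u" using u(2) by (simp add: degree_def)
      moreover have "c u < degree G u" using assms(2) u(1) unfolding stable_def by blast
      ultimately show False by simp
    qed
    then obtain v where v: "v \<in> neighbours G u" "v \<in> insert s S"
      using neighbours_subset[of u] by blast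
    then have "u \<in> neighbours G v"
      using neighbours_sym[of u v] neighbours_subset[of u] u(1) by blast
    moreover have "?P S" "S \<subseteq> fst G - {s}" using S(1) by simp_all
    ultimately have "?P (insert u S)" using step[of S u v] u(1) v(2) by simp
    moreover have "insert u S \<subseteq> fst G - {s}" using S(1) u(1) by simp
    ultimately have "insert u S \<in> ?A" by (intro CollectI conjI)
    then have "S = insert u S" by (rule S(2)[rule_format]) (rule subset_insertI)
    then show False using u(1) by blast
  qed
  then show ?thesis using S(1) by blast
qed

theorem burning_criterion:
  assumes c: "c \<in> configurations G s" and st: "stable G s c"
  shows "recurrent G s c \<longleftrightarrow> allowed G s c"
proof
  assume al: "allowed G s c"
  have "\<exists>e\<in>configurations G s. stabilises_to G s (\<lambda>v. d v + e v) c"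
    if d: "d \<in> configurations G s" for d
  proof -
    obtain k x where x: "(\<lambda>v. c v + k * of_bool (v \<in> neighbours G s)) \<leadsto> x"
      "\<forall>v\<in>fst G - {s}. sum d (fst G) \<le> x v"
      using sink_grains_flood[OF al st] by blast
    have le: "d v \<le> x v" for v
    proof (cases "v \<in> fst G - {s}")
      case True
      then have "d v \<le> sum d (fst G)" using finite_vertices by (intro member_le_sum) auto
      then show ?thesis using x(2) True by (meson order_trans)
    next
      case False
      then show ?thesis using d by (simp add: configurations_def)
    qed
    have "v \<notin> neighbours G s" if "v \<notin> fst G - {s}" for v
      using that loopless[of s] neighbours_subset[of s] by blast
    then have "(\<lambda>v. c v + k * of_bool (v \<in> neighbours G s)) \<in> configurations G s"
      using c by (auto simp: configurations_def)
    from configurations_topples[OF x(1) this]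
    have "(\<lambda>v. x v - d v) \<in> configurations G s" by (auto simp: configurations_def)
    moreover have "stabilises_to G s (\<lambda>v. d v + (x v - d v)) c"
      using topples_to_stable[OF x(1) allowed_absorbs_sink[OF al c] st] st le
      by (simp add: stabilises_to_def)
    ultimately show ?thesis by (intro bexI[of _ "\<lambda>v. x v - d v"])
  qed
  then show "recurrent G s c" using c st by (simp add: recurrent_def)
qed (rule recurrent_imp_allowed)

end

section \<open>Shuffling one letter into a word\<close>

text \<open>A word is determined by the subword of its letters other than \<open>x\<close> and by this list, whose
  entries tell for each occurrence of \<open>x\<close> how many letters of that subword lie to its right.\<close>

fun others_after :: "'a \<Rightarrow> 'a list \<Rightarrow> nat list" where
  "others_after x [] = []"
| "others_after x (y # w) =
    (if y = x then length (filter (\<lambda>z. z \<noteq> x) w) # others_after x w else others_after x w)"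

lemma length_others_after [simp]: "length (others_after x w) = count_list w x"
  by (induction w) auto

lemma others_after_append_notin: "x \<notin> set v \<Longrightarrow> others_after x (v @ w) = others_after x w"
  by (induction v) auto

lemma others_after_notin: "x \<notin> set v \<Longrightarrow> others_after x v = []"
  by (induction v) auto

lemma others_after_le: "f \<in> set (others_after x w) \<Longrightarrow> f \<le> length (filter (\<lambda>z. z \<noteq> x) w)"
  by (induction w) (auto split: if_splits)

lemma others_after_nth:
  "others_after x (xs @ x # ys) ! count_list xs x = length (filter (\<lambda>z. z \<noteq> x) ys)"
  by (induction xs) auto

text \<open>If only one of the words began with \<open>x\<close>, its list would have as an entry the length of the whole
  subword of other letters, while the other word has one such letter before all of its
  occurrences of \<open>x\<close>.\<close>

lemma shuffle_unique:
  assumes "filter (\<lambda>z. z \<noteq> x) v = filter (\<lambda>z. z \<noteq> x) w" and "others_after x v = others_after x w"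
  shows "v = w"
  using assms
proof (induction v arbitrary: w)
  case Nil
  then show ?case by (cases w) (auto split: if_splits)
next
  case (Cons y v)
  show ?case
  proof (cases w)
    case Nil
    then show ?thesis using Cons.prems by (auto split: if_splits)
  next
    case w: (Cons z w')
    have "(y = x) = (z = x)"
    proof (rule ccontr)
      assume "(y = x) \<noteq> (z = x)"
      then consider "y = x" "z \<noteq> x" | "y \<noteq> x" "z = x" by blast
      then show False
      proof cases
        case 1
        then have "others_after x w' = length (filter (\<lambda>z. z \<noteq> x) v) # others_after x v"
          using Cons.prems(2) w by simp
        then have "length (filter (\<lambda>z. z \<noteq> x) v) \<le> length (filter (\<lambda>z. z \<noteq> x) w')"
          by (intro others_after_le) simp
        then show False using 1 Cons.prems(1) w by simp
      next
        case 2
        then have "others_after x v = length (filter (\<lambda>z. z \<noteq> x) w') # others_after x w'"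
          using Cons.prems(2) w by simp
        then have "length (filter (\<lambda>z. z \<noteq> x) w') \<le> length (filter (\<lambda>z. z \<noteq> x) v)"
          by (intro others_after_le) simp
        moreover have "filter (\<lambda>z. z \<noteq> x) w' = y # filter (\<lambda>z. z \<noteq> x) v"
          using 2 Cons.prems(1) w by simp
        ultimately show False by simp
      qed
    qed
    then show ?thesis using Cons w by (cases "y = x") auto
  qed
qed

lemma shuffle_exists:
  assumes "sorted_wrt (\<ge>) fs" and "\<forall>f\<in>set fs. f \<le> length u" and "x \<notin> set u"
  shows "\<exists>w. filter (\<lambda>z. z \<noteq> x) w = u \<and> others_after x w = fs"
  using assms
proof (induction fs arbitrary: u)
  case Nil
  then have "filter (\<lambda>z. z \<noteq> x) u = u" by (auto simp: filter_id_conv)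
  then show ?case
    using others_after_notin[OF Nil.prems(3)] by (intro exI[of _ u] conjI)
next
  case (Cons f fs)
  \<comment> \<open>The first \<open>x\<close> has \<open>f\<close> letters of \<open>u\<close> to its right.\<close>
  let ?k = "length u - f"
  have out: "x \<notin> set (take ?k u)" "x \<notin> set (drop ?k u)"
    using Cons.prems(3) by (auto dest: in_set_takeD in_set_dropD)
  have "\<forall>f'\<in>set fs. f' \<le> length (drop ?k u)" using Cons.prems(1,2) by auto
  then obtain w where w: "filter (\<lambda>z. z \<noteq> x) w = drop ?k u" "others_after x w = fs"
    using Cons.IH[of "drop ?k u"] Cons.prems(1) out(2) by auto
  have "filter (\<lambda>z. z \<noteq> x) (take ?k u) = take ?k u" using out(1) by (auto simp: filter_id_conv)
  then have "filter (\<lambda>z. z \<noteq> x) (take ?k u @ x # w) = u" using w(1) by simp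
  moreover have "others_after x (take ?k u @ x # w) = f # fs"
    using w out(1) Cons.prems(2) by (simp add: others_after_append_notin)
  ultimately show ?case by (intro exI[of _ "take ?k u @ x # w"] conjI)
qed

section \<open>Words that encode a configuration\<close>

lemma after_occurrence_append: "after_occurrence x (Suc (count_list xs x)) (xs @ x # ys) = ys"
proof -
  let ?w = "xs @ x # ys"
  have len: "length (filter (\<lambda>p. ?w ! p = x) [0..<length xs]) = count_list xs x"
  proof -
    have "filter (\<lambda>p. ?w ! p = x) [0..<length xs] = filter (\<lambda>p. xs ! p = x) [0..<length xs]"
      by (rule filter_cong) (auto simp: nth_append)
    moreover have "length (filter (\<lambda>y. y = x) (map (\<lambda>p. xs ! p) [0..<length xs])) = count_list xs x"
      unfolding map_nth by (induction xs) auto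
    ultimately show ?thesis by (simp add: filter_map o_def)
  qed
  have "[0..<length ?w] = [0..<length xs] @ length xs # [Suc (length xs)..<length ?w]"
    using upt_add_eq_append[of 0 "length xs" "Suc (length ys)"]
    by (simp add: upt_conv_Cons del: upt_Suc)
  then have "filter (\<lambda>p. ?w ! p = x) [0..<length ?w] ! count_list xs x = length xs"
    using len by (simp add: nth_append)
  then show ?thesis by (simp add: after_occurrence_def)
qed

lemma split_at_occurrence:
  assumes "i < count_list w x"
  shows "\<exists>xs ys. w = xs @ x # ys \<and> count_list xs x = i"
  using assms
proof (induction w arbitrary: i)
  case (Cons y w)
  show ?case
  proof (cases "y = x \<and> i = 0")
    case True
    then show ?thesis by (intro exI[of _ "[]"] exI[of _ w]) simp
  next
    case False
    then have "(if y = x then i - 1 else i) < count_list w x" using Cons.prems by (auto split: if_splits)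
    then obtain xs ys where "w = xs @ x # ys" "count_list xs x = (if y = x then i - 1 else i)"
      using Cons.IH by blast
    then show ?thesis
      using False by (intro exI[of _ "y # xs"] exI[of _ ys]) (auto split: if_splits)
  qed
qed simp

lemma two_occurrences:
  assumes "xs @ x # ys = xs' @ y # ys'" and "x \<noteq> y"
  shows "(\<exists>zs. ys = zs @ y # ys') \<or> (\<exists>zs. ys' = zs @ x # ys)"
proof -
  obtain us where "us @ x # ys = y # ys' \<or> x # ys = us @ y # ys'"
    using assms(1) by (auto simp: append_eq_append_conv2)
  then show ?thesis using assms(2) by (cases us) auto
qed

lemma count_list_filter: "count_list (filter P w) x = (if P x then count_list w x else 0)"
  by (induction w) auto

lemma length_letters: "length w = count_list w U + count_list w D + count_list w H"
proof (induction w)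
  case (Cons a w)
  then show ?case by (cases a) auto
qed simp

lemma length_filter_letters:
  "length (filter (\<lambda>z. z \<noteq> U) w) = count_list w D + count_list w H"
  "length (filter (\<lambda>z. z \<noteq> H) (filter (\<lambda>z. z \<noteq> U) w)) = count_list w D"
  by (simp_all add: length_letters[of "filter _ _"] count_list_filter del: filter_filter)

lemma filter_D: "filter (\<lambda>z. z \<noteq> H) (filter (\<lambda>z. z \<noteq> U) w) = replicate (count_list w D) D"
proof (induction w)
  case (Cons a w)
  then show ?case by (cases a) auto
qed simp

text \<open>For Motzkin words this is the equation \<open>g m n w = c\<close>, read at one split of the
  word at a time: counting the occurrences before the split replaces the index computation in \<open>after_occurrence\<close>, and the
  added one replaces a subtraction.\<close>

definition encodes :: "letter list \<Rightarrow> (vertex \<Rightarrow> nat) \<Rightarrow> bool" where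
  "encodes w c \<longleftrightarrow>
     (\<forall>xs ys. w = xs @ U # ys \<longrightarrow>
        c (Clique (Suc (count_list xs U))) + 1 = count_list ys D + count_list ys H) \<and>
     (\<forall>xs ys. w = xs @ H # ys \<longrightarrow> c (Indep (Suc (count_list xs H))) = count_list ys D)"

lemma encodes_U:
  "encodes w c \<Longrightarrow> w = xs @ U # ys \<Longrightarrow>
    c (Clique (Suc (count_list xs U))) + 1 = count_list ys D + count_list ys H"
  by (simp add: encodes_def)

lemma encodes_H:
  "encodes w c \<Longrightarrow> w = xs @ H # ys \<Longrightarrow> c (Indep (Suc (count_list xs H))) = count_list ys D"
  by (simp add: encodes_def)

text \<open>Thus \<open>w\<close> arises from \<open>D\<close>'s by shuffling in first the \<open>H\<close>'s, then the \<open>U\<close>'s.\<close>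

lemma encodes_iff_others_after:
  "encodes w c \<longleftrightarrow>
     others_after U w = map (\<lambda>i. c (Clique (Suc i)) + 1) [0..<count_list w U] \<and>
     others_after H (filter (\<lambda>z. z \<noteq> U) w) = map (\<lambda>j. c (Indep (Suc j))) [0..<count_list w H]"
  (is "_ \<longleftrightarrow> ?U \<and> ?H")
proof -
  have nthU: "others_after U w ! count_list xs U = count_list ys D + count_list ys H"
    if "w = xs @ U # ys" for xs ys
    using others_after_nth[of U xs ys] that by (simp add: length_filter_letters)
  have nthH: "others_after H (filter (\<lambda>z. z \<noteq> U) w) ! count_list xs H = count_list ys D"
    if "w = xs @ H # ys" for xs ys
    using others_after_nth[of H "filter (\<lambda>z. z \<noteq> U) xs" "filter (\<lambda>z. z \<noteq> U) ys"] that
    by (simp add: length_filter_letters count_list_filter del: filter_filter)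
  show ?thesis
  proof
    assume enc: "encodes w c"
    have ?U
    proof (rule nth_equalityI)
      fix i assume "i < length (others_after U w)"
      then have i: "i < count_list w U" by simp
      from split_at_occurrence[OF i] obtain xs ys where "w = xs @ U # ys" "count_list xs U = i"
        by blast
      then have "others_after U w ! i = c (Clique (Suc i)) + 1"
        using nthU[of xs ys] encodes_U[OF enc, of xs ys] by simp
      then show "others_after U w ! i = map (\<lambda>i. c (Clique (Suc i)) + 1) [0..<count_list w U] ! i"
        using i by simp
    qed simp
    moreover have ?H
    proof (rule nth_equalityI)
      fix j assume "j < length (others_after H (filter (\<lambda>z. z \<noteq> U) w))"
      then have j: "j < count_list w H" by (simp add: count_list_filter)
      from split_at_occurrence[OF j] obtain xs ys where "w = xs @ H # ys" "count_list xs H = j"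
        by blast
      then have "others_after H (filter (\<lambda>z. z \<noteq> U) w) ! j = c (Indep (Suc j))"
        using nthH[of xs ys] encodes_H[OF enc, of xs ys] by (simp del: filter_filter)
      then show "others_after H (filter (\<lambda>z. z \<noteq> U) w) ! j
          = map (\<lambda>j. c (Indep (Suc j))) [0..<count_list w H] ! j"
        using j by simp
    qed (simp add: count_list_filter)
    ultimately show "?U \<and> ?H" ..
  next
    assume UH: "?U \<and> ?H"
    show "encodes w c"
      unfolding encodes_def
    proof (intro conjI allI impI)
      fix xs ys assume w: "w = xs @ U # ys"
      then have "count_list xs U < count_list w U" by simp
      then have "others_after U w ! count_list xs U = c (Clique (Suc (count_list xs U))) + 1"
        unfolding UH[THEN conjunct1] by simp
      then show "c (Clique (Suc (count_list xs U))) + 1 = count_list ys D + count_list ys H"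
        using nthU[OF w] by simp
    next
      fix xs ys assume w: "w = xs @ H # ys"
      then have "count_list xs H < count_list w H" by simp
      then have "others_after H (filter (\<lambda>z. z \<noteq> U) w) ! count_list xs H
          = c (Indep (Suc (count_list xs H)))"
        unfolding UH[THEN conjunct2] by simp
      then show "c (Indep (Suc (count_list xs H))) = count_list ys D"
        using nthH[OF w] by simp
    qed
  qed
qed

lemma encodes_unique:
  assumes "encodes v c" and "encodes w c" and "\<And>x. count_list v x = count_list w x"
  shows "v = w"
proof -
  have "filter (\<lambda>z. z \<noteq> U) v = filter (\<lambda>z. z \<noteq> U) w"
    by (rule shuffle_unique[of H])
      (use assms in \<open>simp_all add: encodes_iff_others_after filter_D del: filter_filter\<close>)
  then show ?thesis
    by (rule shuffle_unique) (use assms in \<open>simp add: encodes_iff_others_after\<close>)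
qed

lemma encodes_exists:
  assumes "weakly_decreasing m n c"
    and "\<forall>i\<in>{1..m}. c (Clique i) + 1 < m + n" and "\<forall>j\<in>{1..n - 1}. c (Indep j) \<le> m"
  shows "\<exists>w. encodes w c \<and> count_list w U = m \<and> count_list w H = n - 1 \<and> count_list w D = m"
proof -
  let ?b = "map (\<lambda>j. c (Indep (Suc j))) [0..<n - 1]"
  let ?a = "map (\<lambda>i. c (Clique (Suc i)) + 1) [0..<m]"
  have "\<exists>v. filter (\<lambda>z. z \<noteq> H) v = replicate m D \<and> others_after H v = ?b"
    by (rule shuffle_exists)
      (use assms in \<open>auto simp: weakly_decreasing_def sorted_wrt_iff_nth_less\<close>)
  then obtain v where v: "filter (\<lambda>z. z \<noteq> H) v = replicate m D" "others_after H v = ?b" by blast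
  have "count_list v U = count_list (filter (\<lambda>z. z \<noteq> H) v) U" by (simp add: count_list_filter)
  then have vU: "count_list v U = 0" using v(1) by (simp add: count_list_0_iff)
  have "count_list v D = count_list (filter (\<lambda>z. z \<noteq> H) v) D" by (simp add: count_list_filter)
  also have "\<dots> = length (filter (\<lambda>z. z \<noteq> H) v)"
    unfolding v(1) by (induction m) auto
  finally have vD: "count_list v D = m" using v(1) by simp
  have vH: "count_list v H = n - 1" using length_others_after[of H v] v(2) by simp
  have "\<exists>w. filter (\<lambda>z. z \<noteq> U) w = v \<and> others_after U w = ?a"
  proof (rule shuffle_exists)
    show "\<forall>f\<in>set ?a. f \<le> length v"
    proof -
      have "c (Clique (Suc i)) + 1 \<le> m + (n - 1)" if "i < m" for i
        using that assms(2)[rule_format, of "Suc i"] by simp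
      then show ?thesis using length_letters[of v] vU vD vH by auto
    qed
    show "U \<notin> set v" using vU by (simp add: count_list_0_iff)
  qed (use assms(1) in \<open>auto simp: weakly_decreasing_def sorted_wrt_iff_nth_less\<close>)
  then obtain w where w: "filter (\<lambda>z. z \<noteq> U) w = v" "others_after U w = ?a" by blast
  have wU: "count_list w U = m" using length_others_after[of U w] w(2) by simp
  have wHD: "count_list w H = n - 1" "count_list w D = m"
    using vH vD count_list_filter[of "\<lambda>z. z \<noteq> U" w] w(1) by auto
  have "encodes w c"
    unfolding encodes_iff_others_after by (simp only: w v(2) wU wHD simp_thms)
  then show ?thesis using wU wHD by (intro exI[of _ w] conjI)
qed

section \<open>Motzkin words\<close>

text \<open>Because the word is balanced, a bad prefix is the complement of a suffix with more \<open>U\<close>'s than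
  \<open>D\<close>'s, and such a suffix may be cut further so that it starts with a \<open>U\<close>.\<close>

lemma motzkin_word_iff:
  assumes "count_list w U = count_list w D"
  shows "motzkin_word w \<longleftrightarrow> (\<forall>xs ys. w = xs @ U # ys \<longrightarrow> count_list ys U < count_list ys D)"
proof
  assume mw: "motzkin_word w"
  show "\<forall>xs ys. w = xs @ U # ys \<longrightarrow> count_list ys U < count_list ys D"
  proof (intro allI impI)
    fix xs ys assume w: "w = xs @ U # ys"
    have "length xs \<le> length w" using w by simp
    then have "count_list (take (length xs) w) D \<le> count_list (take (length xs) w) U"
      using mw by (simp add: motzkin_word_def)
    then show "count_list ys U < count_list ys D" using w assms by simp
  qed
next
  assume r: "\<forall>xs ys. w = xs @ U # ys \<longrightarrow> count_list ys U < count_list ys D"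
  have "count_list (take k w) D \<le> count_list (take k w) U" for k
  proof (rule ccontr)
    assume gt: "\<not> ?thesis"
    have split: "count_list w x = count_list (take k w) x + count_list (drop k w) x" for x
      by (metis append_take_drop_id count_list_append)
    have less: "count_list (drop k w) D < count_list (drop k w) U"
      using gt assms split[of U] split[of D] by linarith
    then have "count_list (drop k w) U \<noteq> 0" by simp
    then have "U \<in> set (drop k w)" by (simp add: count_list_0_iff)
    then obtain pre ys where z: "drop k w = pre @ U # ys" "U \<notin> set pre"
      using split_list_first by fastforce
    have "w = (take k w @ pre) @ U # ys"
      using append_take_drop_id[of k w] z(1) by simp
    with r have "count_list ys U < count_list ys D" by blast
    then show False using less z by (simp add: count_list_0_iff)
  qed
  then show "motzkin_word w" using assms by (simp add: motzkin_word_def)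
qed

text \<open>In a Motzkin word every \<open>U\<close> is followed by a \<open>D\<close>, so the subtraction in \<open>g\<close> is exact.\<close>

lemma g_eq_iff_encodes:
  assumes "w \<in> Motzkin m (n - 1)" and "c \<in> configurations (complete_split_graph m n) (Indep n)"
  shows "g m n w = c \<longleftrightarrow> encodes w c"
proof -
  have cnt: "count_list w U = m" "count_list w H = n - 1" and mw: "motzkin_word w"
    using assms(1) by (auto simp: Motzkin_def)
  have pos: "0 < count_list ys D" if "w = xs @ U # ys" for xs ys
    using mw that motzkin_word_iff[of w] unfolding motzkin_word_def by fastforce
  have gU: "g m n w (Clique (Suc (count_list xs U))) + 1 = count_list ys D + count_list ys H"
    if w: "w = xs @ U # ys" for xs ys
  proof -
    have "count_list xs U < m" using cnt(1) w by simp
    then show ?thesis using pos[OF w] after_occurrence_append[of U xs ys] w by (simp add: g_def)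
  qed
  have gH: "g m n w (Indep (Suc (count_list xs H))) = count_list ys D"
    if w: "w = xs @ H # ys" for xs ys
  proof -
    have "count_list xs H < n - 1" using cnt(2) w by simp
    then show ?thesis using after_occurrence_append[of H xs ys] w by (simp add: g_def)
  qed
  show ?thesis
  proof
    assume "g m n w = c"
    then show "encodes w c" using gU gH by (auto simp: encodes_def)
  next
    assume enc: "encodes w c"
    show "g m n w = c"
    proof
      fix v
      show "g m n w v = c v"
      proof (cases v)
        case (Clique i)
        show ?thesis
        proof (cases "1 \<le> i \<and> i \<le> m")
          case True
          then have "i - 1 < count_list w U" using cnt by linarith
          from split_at_occurrence[OF this]
          obtain xs ys where xs: "w = xs @ U # ys" "count_list xs U = i - 1"
            by blast
          then have "c (Clique i) + 1 = count_list ys D + count_list ys H"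
            using encodes_U[OF enc xs(1)] True by simp
          moreover have "g m n w (Clique i) + 1 = count_list ys D + count_list ys H"
            using gU[OF xs(1)] xs(2) True by simp
          ultimately show ?thesis using Clique by simp
        next
          case False
          then have "v \<notin> fst (complete_split_graph m n)"
            using Clique by (auto simp: complete_split_graph_def)
          then show ?thesis using assms(2) False Clique by (auto simp: configurations_def g_def)
        qed
      next
        case (Indep j)
        show ?thesis
        proof (cases "1 \<le> j \<and> j \<le> n - 1")
          case True
          then have "j - 1 < count_list w H" using cnt by linarith
          from split_at_occurrence[OF this]
          obtain xs ys where xs: "w = xs @ H # ys" "count_list xs H = j - 1"
            by blast
          then have "c (Indep j) = count_list ys D"
            using encodes_H[OF enc xs(1)] True by simp
          moreover have "g m n w (Indep j) = count_list ys D"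
            using gH[OF xs(1)] xs(2) True by simp
          ultimately show ?thesis using Indep by simp
        next
          case False
          then have "v \<notin> fst (complete_split_graph m n) - {Indep n}"
            using Indep by (auto simp: complete_split_graph_def)
          then show ?thesis using assms(2) False Indep by (auto simp: configurations_def g_def)
        qed
      qed
    qed
  qed
qed

section \<open>The complete split graph\<close>

lemma edge_Clique_Clique:
  "{Clique i, Clique j} \<in> snd (complete_split_graph m n) \<longleftrightarrow> i \<in> {1..m} \<and> j \<in> {1..m} \<and> i \<noteq> j"
  by (simp add: complete_split_graph_def doubleton_eq_iff) metis

lemma edge_Clique_Indep:
  "{Clique i, Indep j} \<in> snd (complete_split_graph m n) \<longleftrightarrow> i \<in> {1..m} \<and> j \<in> {1..n}"
  by (auto simp: complete_split_graph_def doubleton_eq_iff)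

lemma edge_Indep_Indep: "{Indep i, Indep j} \<notin> snd (complete_split_graph m n)"
  by (auto simp: complete_split_graph_def doubleton_eq_iff)

lemma Int_vertices:
  "(Clique ` A \<union> Indep ` B) \<inter> (Clique ` P \<union> Indep ` Q) = Clique ` (A \<inter> P) \<union> Indep ` (B \<inter> Q)"
  by auto

lemma vertices_complete_split_graph:
  "fst (complete_split_graph m n) = Clique ` {1..m} \<union> Indep ` {1..n}"
  by (simp add: complete_split_graph_def)

lemma neighbours_Clique:
  assumes "i \<in> {1..m}"
  shows "neighbours (complete_split_graph m n) (Clique i) = Clique ` ({1..m} - {i}) \<union> Indep ` {1..n}"
  using assms
  by (auto simp: neighbours_def vertices_complete_split_graph edge_Clique_Clique edge_Clique_Indep
      simp del: One_nat_def)

lemma neighbours_Indep: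
  assumes "j \<in> {1..n}"
  shows "neighbours (complete_split_graph m n) (Indep j) = Clique ` {1..m}"
  using assms
  by (auto simp: neighbours_def vertices_complete_split_graph edge_Indep_Indep
      insert_commute[of "Indep j"] edge_Clique_Indep simp del: One_nat_def)

lemma inj_vertex: "inj_on Clique A" "inj_on Indep B"
  by (auto simp: inj_on_def)

lemma card_vertices:
  assumes "finite A" and "finite B"
  shows "card (Clique ` A \<union> Indep ` B) = card A + card B"
  using assms by (subst card_Un_disjoint) (auto simp: card_image inj_vertex)

lemma degree_Clique: "i \<in> {1..m} \<Longrightarrow> degree (complete_split_graph m n) (Clique i) + 1 = m + n"
  by (simp add: degree_def neighbours_Clique card_vertices)

lemma degree_Indep: "j \<in> {1..n} \<Longrightarrow> degree (complete_split_graph m n) (Indep j) = m"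
  by (simp add: degree_def neighbours_Indep card_image inj_vertex)

text \<open>Inside the set formed by \<open>P\<close> and \<open>Q\<close>, a clique vertex is adjacent to all but itself, an
  independent vertex exactly to \<open>P\<close>.\<close>

lemma allowed_complete_split_graph:
  assumes "1 \<le> n"
  shows "allowed (complete_split_graph m n) (Indep n) c \<longleftrightarrow>
    (\<forall>P Q. P \<subseteq> {1..m} \<and> Q \<subseteq> {1..n - 1} \<and> (P \<noteq> {} \<or> Q \<noteq> {}) \<longrightarrow>
       (\<exists>i\<in>P. card P + card Q \<le> c (Clique i) + 1) \<or> (\<exists>j\<in>Q. card P \<le> c (Indep j)))"
    (is "_ \<longleftrightarrow> (\<forall>P Q. ?sub P Q \<longrightarrow> ?ok P Q)")
proof -
  let ?G = "complete_split_graph m n"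
  have V: "fst ?G - {Indep n} = Clique ` {1..m} \<union> Indep ` {1..n - 1}"
  proof -
    have "{1..n} = insert n {1..n - 1}" using assms by auto
    then have "fst ?G = insert (Indep n) (Clique ` {1..m} \<union> Indep ` {1..n - 1})"
      by (simp add: vertices_complete_split_graph)
    moreover have "Indep n \<notin> Clique ` {1..m} \<union> Indep ` {1..n - 1}" using assms by auto
    ultimately show ?thesis by (simp only: Diff_insert_absorb not_False_eq_True)
  qed
  have ok: "(\<exists>v\<in>Clique ` P \<union> Indep ` Q. card (neighbours ?G v \<inter> (Clique ` P \<union> Indep ` Q)) \<le> c v)
      \<longleftrightarrow> ?ok P Q" if PQ: "P \<subseteq> {1..m}" "Q \<subseteq> {1..n - 1}" for P Q
  proof -
    have fin: "finite P" "finite Q" using PQ finite_subset by blast+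
    have Qn: "Q \<subseteq> {1..n}" by (rule order_trans[OF PQ(2)]) auto
    have c1: "card (neighbours ?G (Clique i) \<inter> (Clique ` P \<union> Indep ` Q)) \<le> c (Clique i)
        \<longleftrightarrow> card P + card Q \<le> c (Clique i) + 1"
      if "i \<in> P" for i
    proof -
      have "neighbours ?G (Clique i) \<inter> (Clique ` P \<union> Indep ` Q) = Clique ` (P - {i}) \<union> Indep ` Q"
      proof -
        have "({1..m} - {i}) \<inter> P = P - {i}" using PQ(1) by blast
        moreover have "{1..n} \<inter> Q = Q" using Qn by blast
        moreover have "i \<in> {1..m}" using that PQ(1) by blast
        ultimately show ?thesis by (simp only: neighbours_Clique Int_vertices)
      qed
      moreover have "0 < card P" using that fin by (auto simp: card_gt_0_iff)
      ultimately show ?thesis using that fin by (auto simp: card_vertices)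
    qed
    have c2: "card (neighbours ?G (Indep j) \<inter> (Clique ` P \<union> Indep ` Q)) = card P"
      if "j \<in> Q" for j
    proof -
      have "neighbours ?G (Indep j) \<inter> (Clique ` P \<union> Indep ` Q) = Clique ` P"
      proof -
        have "{1..m} \<inter> P = P" using PQ(1) by blast
        moreover have "j \<in> {1..n}" using that Qn by blast
        ultimately show ?thesis
          using Int_vertices[of "{1..m}" "{}" P Q] by (simp only: neighbours_Indep) simp
      qed
      then show ?thesis by (simp add: card_image inj_vertex)
    qed
    show ?thesis by (simp add: bex_Un c1 c2 cong: bex_cong)
  qed
  show ?thesis
  proof
    assume al: "allowed ?G (Indep n) c"
    show "\<forall>P Q. ?sub P Q \<longrightarrow> ?ok P Q"
    proof (intro allI impI)
      fix P Q assume sub: "?sub P Q"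
      then have "Clique ` P \<union> Indep ` Q \<noteq> {}" "Clique ` P \<union> Indep ` Q \<subseteq> fst ?G - {Indep n}"
        unfolding V by auto
      then have "\<exists>v\<in>Clique ` P \<union> Indep ` Q.
          card (neighbours ?G v \<inter> (Clique ` P \<union> Indep ` Q)) \<le> c v"
        using al by (simp only: allowed_def simp_thms)
      then show "?ok P Q" using ok sub by simp
    qed
  next
    assume r: "\<forall>P Q. ?sub P Q \<longrightarrow> ?ok P Q"
    show "allowed ?G (Indep n) c"
      unfolding allowed_def
    proof (intro allI impI)
      fix F assume F: "F \<noteq> {} \<and> F \<subseteq> fst ?G - {Indep n}"
      let ?P = "{i. Clique i \<in> F}" and ?Q = "{j. Indep j \<in> F}"
      have PQ: "?P \<subseteq> {1..m}" "?Q \<subseteq> {1..n - 1}" using F unfolding V by auto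
      have FPQ: "F = Clique ` ?P \<union> Indep ` ?Q" using F unfolding V by auto
      then have "?P \<noteq> {} \<or> ?Q \<noteq> {}" using F by blast
      then have "?ok ?P ?Q" using r[rule_format, of ?P ?Q] PQ by simp
      then show "\<exists>v\<in>F. card (neighbours ?G v \<inter> F) \<le> c v"
        using ok[OF PQ] FPQ by simp
    qed
  qed
qed

text \<open>A suffix \<open>U # ys\<close> with too few \<open>D\<close>'s gives a forbidden set, namely the vertices whose letters
  lie in it. Monotonicity of \<open>c\<close> reduces the check to the first clique and the first
  independent vertex of that set.\<close>

lemma allowed_imp_motzkin_word:
  assumes n: "1 \<le> n" and al: "allowed (complete_split_graph m n) (Indep n) c"
    and dec: "weakly_decreasing m n c" and enc: "encodes w c"
    and cnt: "count_list w U = m" "count_list w H = n - 1" "count_list w D = m"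
  shows "motzkin_word w"
proof (rule ccontr)
  assume "\<not> motzkin_word w"
  then obtain xs ys where w: "w = xs @ U # ys" and less: "count_list ys D \<le> count_list ys U"
    using motzkin_word_iff[of w] cnt by (auto simp: not_less)
  let ?i = "Suc (count_list xs U)" and ?j = "Suc (count_list xs H)"
  let ?P = "{?i..m}" and ?Q = "{?j..n - 1}"
  have P: "card ?P = count_list ys U + 1" and Q: "card ?Q = count_list ys H"
    using cnt w by auto
  have "?i \<le> m" using cnt w by auto
  then have "?P \<noteq> {}" by simp
  moreover have "?P \<subseteq> {1..m}" "?Q \<subseteq> {1..n - 1}" by auto
  ultimately consider i where "i \<in> ?P" "card ?P + card ?Q \<le> c (Clique i) + 1"
    | j where "j \<in> ?Q" "card ?P \<le> c (Indep j)"
    using al[unfolded allowed_complete_split_graph[OF n], rule_format, of ?P ?Q] by blast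
  then show False
  proof cases
    case 1
    have "c (Clique i) \<le> c (Clique ?i)"
      using dec 1(1) unfolding weakly_decreasing_def by simp
    then show False using 1(2) P Q less encodes_U[OF enc w] by linarith
  next
    case 2
    then have "count_list ys H \<noteq> 0" using Q by (metis card_eq_0_iff empty_iff finite_atLeastAtMost)
    then have "H \<in> set ys" by (simp add: count_list_0_iff)
    then obtain zs ts where ys: "ys = zs @ H # ts" "H \<notin> set zs" using split_list_first by metis
    then have "w = (xs @ U # zs) @ H # ts" "count_list (xs @ U # zs) H = count_list xs H"
      using w by (simp_all add: count_list_0_iff)
    then have "c (Indep ?j) = count_list ts D" using encodes_H[OF enc] by metis
    moreover have "c (Indep j) \<le> c (Indep ?j)"
      using dec 2(1) unfolding weakly_decreasing_def by simp
    ultimately show False using 2(2) P less ys(1) by simp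
  qed
qed

text \<open>It suffices to look at the first clique vertex and the first independent vertex of the given set,
  that is, at one \<open>U\<close> and one \<open>H\<close> of the word. The \<open>U\<close> is followed by at least \<open>card P\<close> letters \<open>D\<close>. If
  at least \<open>card Q\<close> letters \<open>H\<close> follow it as well, then the clique vertex is large enough. If not,
  the \<open>H\<close> comes before the \<open>U\<close>, so at least \<open>card P\<close> letters \<open>D\<close> follow it too, and the independent
  vertex is large enough.\<close>

lemma motzkin_word_imp_allowed:
  assumes n: "1 \<le> n" and mw: "motzkin_word w" and enc: "encodes w c"
    and cnt: "count_list w U = m" "count_list w H = n - 1"
  shows "allowed (complete_split_graph m n) (Indep n) c"
  unfolding allowed_complete_split_graph[OF n]
proof (intro allI impI, elim conjE)
  fix P Q assume P: "P \<subseteq> {1..m}" and Q: "Q \<subseteq> {1..n - 1}" and ne: "P \<noteq> {} \<or> Q \<noteq> {}"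
  have fin: "finite P" "finite Q" using P Q finite_subset by blast+
  show "(\<exists>i\<in>P. card P + card Q \<le> c (Clique i) + 1) \<or> (\<exists>j\<in>Q. card P \<le> c (Indep j))"
  proof (cases "P = {}")
    case True
    then show ?thesis using ne by auto
  next
    case False
    define i where "i = Min P"
    have i: "i \<in> P" "P \<subseteq> {i..m}" using False fin P by (auto simp: i_def)
    then have "1 \<le> i" "i \<le> m" using P by auto
    then have "i - 1 < count_list w U" using cnt by linarith
    from split_at_occurrence[OF this]
    obtain xs ys where w: "w = xs @ U # ys" and xs: "count_list xs U = i - 1" by blast
    have ci: "c (Clique i) + 1 = count_list ys D + count_list ys H"
      using encodes_U[OF enc w] xs \<open>1 \<le> i\<close> by simp
    have "card P \<le> card {i..m}" using i(2) by (intro card_mono) auto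
    also have "\<dots> = count_list ys U + 1" using cnt(1) w xs \<open>1 \<le> i\<close> by simp
    also have "\<dots> \<le> count_list ys D"
      using mw w motzkin_word_iff[of w] by (simp add: motzkin_word_def Suc_le_eq)
    finally have p: "card P \<le> count_list ys D" .
    show ?thesis
    proof (cases "card Q \<le> count_list ys H")
      case True
      then have "card P + card Q \<le> c (Clique i) + 1" using p ci by linarith
      then show ?thesis using i(1) by blast
    next
      case False
      then have "Q \<noteq> {}" by auto
      define j where "j = Min Q"
      have j: "j \<in> Q" "Q \<subseteq> {j..n - 1}" using \<open>Q \<noteq> {}\<close> fin Q by (auto simp: j_def)
      then have "1 \<le> j" "j \<le> n - 1" using Q by auto
      then have "j - 1 < count_list w H" using cnt by linarith
      from split_at_occurrence[OF this]
      obtain xs' ys' where w': "w = xs' @ H # ys'" and xs': "count_list xs' H = j - 1" by blast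
      have cj: "c (Indep j) = count_list ys' D"
        using encodes_H[OF enc w'] xs' \<open>1 \<le> j\<close> by simp
      have "card Q \<le> card {j..n - 1}" using j(2) by (intro card_mono) auto
      also have "\<dots> = count_list ys' H + 1" using cnt(2) w' xs' \<open>1 \<le> j\<close> by simp
      finally have "count_list ys H < count_list ys' H + 1" using False by linarith
      then have "\<nexists>zs. ys = zs @ H # ys'" by auto
      then obtain zs where "ys' = zs @ U # ys" using two_occurrences[of xs U ys xs' H ys'] w w' by auto
      then have "card P \<le> c (Indep j)" using p cj by simp
      then show ?thesis using j(1) by blast
    qed
  qed
qed

text \<open>If there is an \<open>H\<close>, then \<open>c (Indep 1)\<close> is the number of \<open>D\<close>'s after the first one, and it is less
  than the total exactly if some \<open>D\<close> comes earlier.\<close>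

lemma encodes_imp_DH_Motzkin_word:
  assumes "motzkin_word w" and "encodes w c" and "c (Indep 1) < count_list w D \<or> count_list w H = 0"
  shows "DH_Motzkin_word w"
  unfolding DH_Motzkin_word_def
proof (intro conjI allI impI)
  fix xs ys assume w: "w = xs @ H # ys \<and> H \<notin> set xs"
  then have "c (Indep 1) = count_list ys D"
    using encodes_H[OF assms(2), of xs ys] by (simp add: count_list_0_iff)
  then have "count_list xs D \<noteq> 0" using assms(3) w by auto
  then show "D \<in> set xs" by (simp add: count_list_0_iff)
qed (rule assms(1))

theorem theorem3p6:
  fixes m n :: nat and c :: "vertex \<Rightarrow> nat"
  assumes "m \<ge> 1" and "n \<ge> 1"
    and "c \<in> configurations (complete_split_graph m n) (Indep n)"
    and "stable (complete_split_graph m n) (Indep n) c"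
    and "weakly_decreasing m n c"
  shows "recurrent (complete_split_graph m n) (Indep n) c \<longleftrightarrow>
    (\<exists>!\<alpha>. \<alpha> \<in> Motzkin m (n - 1) \<and> DH_Motzkin_word \<alpha> \<and> g m n \<alpha> = c)"
proof -
  let ?G = "complete_split_graph m n"
  interpret loopless_graph_with_sink ?G "Indep n"
  proof
    show "finite (fst ?G)" and "Indep n \<in> fst ?G"
      using assms(2) by (auto simp: complete_split_graph_def)
    show "v \<notin> neighbours ?G v" for v
      by (auto simp: neighbours_def complete_split_graph_def doubleton_eq_iff)
  qed
  have clique: "c (Clique i) + 1 < m + n" if "i \<in> {1..m}" for i
  proof -
    have "Clique i \<in> fst ?G - {Indep n}" using that by (auto simp: complete_split_graph_def)
    with assms(4) have "c (Clique i) < degree ?G (Clique i)" unfolding stable_def by (rule bspec)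
    then show ?thesis using degree_Clique[OF that, of n] by simp
  qed
  have indep: "c (Indep j) < m" if "j \<in> {1..n - 1}" for j
  proof -
    have j: "j \<in> {1..n}" "j \<noteq> n" using that by auto
    then have "Indep j \<in> fst ?G - {Indep n}" unfolding vertices_complete_split_graph by blast
    with assms(4) have "c (Indep j) < degree ?G (Indep j)" unfolding stable_def by (rule bspec)
    then show ?thesis using degree_Indep[OF j(1), of m] by simp
  qed
  obtain w where enc: "encodes w c"
    and cnt: "count_list w U = m" "count_list w H = n - 1" "count_list w D = m"
    using encodes_exists[OF assms(5)] clique indep by (meson less_imp_le)
  have rec: "recurrent ?G (Indep n) c \<longleftrightarrow> motzkin_word w"
    unfolding burning_criterion[OF assms(3,4)]
    using allowed_imp_motzkin_word[OF assms(2) _ assms(5) enc cnt]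
      motzkin_word_imp_allowed[OF assms(2) _ enc cnt(1,2)] by blast
  have only: "\<alpha> = w" if \<alpha>: "\<alpha> \<in> Motzkin m (n - 1)" "g m n \<alpha> = c" for \<alpha>
  proof (rule encodes_unique[OF _ enc])
    show "encodes \<alpha> c" using \<alpha> g_eq_iff_encodes[OF \<alpha>(1) assms(3)] by blast
    show "count_list \<alpha> x = count_list w x" for x
      using \<alpha>(1) cnt by (cases x) (auto simp: Motzkin_def motzkin_word_def)
  qed
  show ?thesis
  proof
    assume "recurrent ?G (Indep n) c"
    then have mw: "motzkin_word w" using rec by blast
    then have M: "w \<in> Motzkin m (n - 1)" using cnt by (simp add: Motzkin_def)
    have "c (Indep 1) < count_list w D \<or> count_list w H = 0"
      using indep[of 1] cnt by (cases "n - 1 = 0") auto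
    then have "DH_Motzkin_word w" by (rule encodes_imp_DH_Motzkin_word[OF mw enc])
    moreover have "g m n w = c" using g_eq_iff_encodes[OF M assms(3)] enc by blast
    ultimately show "\<exists>!\<alpha>. \<alpha> \<in> Motzkin m (n - 1) \<and> DH_Motzkin_word \<alpha> \<and> g m n \<alpha> = c"
      using M only by blast
  next
    assume "\<exists>!\<alpha>. \<alpha> \<in> Motzkin m (n - 1) \<and> DH_Motzkin_word \<alpha> \<and> g m n \<alpha> = c"
    then obtain \<alpha> where \<alpha>: "\<alpha> \<in> Motzkin m (n - 1)" "g m n \<alpha> = c" by blast
    then have "motzkin_word w" using only[OF \<alpha>] by (simp add: Motzkin_def)
    then show "recurrent ?G (Indep n) c" using rec by blast
  qed
qed

end
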